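(* Let $q=p^e$ be a prime power and $S=S(q)=\mathcal{R}/\mathcal{I}(q)\Sigma$. Suppose the surjective map $\gamma:F(\mathcal{R}[t,t^{-1}])\to G$ is determined by the ring map $\mathcal{R}\to S$ (that is, $\gamma$ is the result of sending $\mathcal{R}$ into $S$). Then $G$ (the image of $\gamma$) is solvable.
   Context: $\mathcal{R}=\mathbb{Z}[x,x^{-1},y,y^{-1}]$ is the Laurent polynomial ring with integer coefficients; its positive units are the monomials $x^iy^j$, $i,j\in\mathbb{Z}$. $\Sigma$ is the augmentation ideal of $\mathcal{R}$ (generated by $1-x$ and $1-y$). $\mathcal{I}(q)$ is the ideal of $\mathcal{R}$ generated by all elements $1+u+u^2+\cdots+u^{q-1}$ with $u$ a positive unit of $\mathcal{R}$. The ring map $\mathcal{R}\to S$ is the quotient map. $F(\mathcal{R}[t,t^{-1}])$ is the (free, rank 2) group generated by the $2\times 2$ matrices $$M_1=\begin{pmatrix}1&1-y\\0&x\end{pmatrix},\qquad M_2T=\begin{pmatrix}yt&0\\1-xt&1\end{pmatrix}$$ over $\mathcal{R}[t,t^{-1}]$. The special case $G=F(S[t,t^{-1}])$, the group generated by the same matrices with entries read in $S[t,t^{-1}]$, arises from the map that sends $\mathcal{R}$ to $S$ while fixing $t$; for general $G$ the hypothesis is that the elements of $\mathcal{R}$ are sent to $S$ in the map $\gamma$. *)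

theory Defs
  imports
    "HOL-Algebra.Solvable_Groups"
    "HOL-Algebra.QuotRing"
    "HOL-Algebra.Ideal_Product"
    "HOL-Algebra.Algebraic_Closure_Type"
    "HOL-Library.Poly_Mapping"
    "HOL-Library.Product_Plus"
begin

section \<open>The Laurent polynomial rings\<close>

text \<open>
  Laurent polynomials are finitely supported functions from exponents to coefficients; the
  multiplication that \<^theory>\<open>HOL-Library.Poly_Mapping\<close> puts on them is convolution. Thus
  \<open>laurent_xy\<close> is $Z[x,x^{-1},y,y^{-1}]$ and \<open>laurent_xyt\<close> is $Z[x,x^{-1},y,y^{-1}][t,t^{-1}]$.
\<close>

type_synonym laurent_xy = "(int \<times> int) \<Rightarrow>\<^sub>0 int"
type_synonym laurent_xyt = "int \<Rightarrow>\<^sub>0 laurent_xy"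

abbreviation R_ring :: "laurent_xy ring" where
  "R_ring \<equiv> ring_of_type_algebra"

abbreviation Rt_ring :: "laurent_xyt ring" where
  "Rt_ring \<equiv> ring_of_type_algebra"

definition mono_xy :: "int \<Rightarrow> int \<Rightarrow> laurent_xy" where
  "mono_xy i j = Poly_Mapping.single (i, j) 1"

abbreviation x_var :: laurent_xy where "x_var \<equiv> mono_xy 1 0"
abbreviation y_var :: laurent_xy where "y_var \<equiv> mono_xy 0 1"

definition positive_units :: "laurent_xy set" where
  "positive_units = {mono_xy i j | i j. True}"

text \<open>The inclusion of \<open>laurent_xy\<close> as the coefficients of \<open>laurent_xyt\<close>.\<close>

definition const_t :: "laurent_xy \<Rightarrow> laurent_xyt" where
  "const_t r = Poly_Mapping.single 0 r"

definition t_var :: laurent_xyt where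
  "t_var = Poly_Mapping.single 1 1"


section \<open>The ring \<open>S(q)\<close>\<close>

definition Sigma_ideal :: "laurent_xy set" where
  "Sigma_ideal = Idl\<^bsub>R_ring\<^esub> {1 - x_var, 1 - y_var}"

definition I_ideal :: "nat \<Rightarrow> laurent_xy set" where
  "I_ideal q = Idl\<^bsub>R_ring\<^esub> {\<Sum>k<q. u ^ k | u. u \<in> positive_units}"

definition ISigma_ideal :: "nat \<Rightarrow> laurent_xy set" where
  "ISigma_ideal q = ideal_prod R_ring (I_ideal q) Sigma_ideal"

definition S_ring :: "nat \<Rightarrow> laurent_xy set ring" where
  "S_ring q = R_ring Quot ISigma_ideal q"

definition to_S :: "nat \<Rightarrow> laurent_xy \<Rightarrow> laurent_xy set" where
  "to_S q r = ISigma_ideal q +>\<^bsub>R_ring\<^esub> r"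


section \<open>Matrices of size two over a ring\<close>

text \<open>\<open>Mat2 a b c d\<close> has rows $(a, b)$ and $(c, d)$. The datatype package supplies the
  entrywise application \<open>map_mat2\<close> and the set of entries \<open>set_mat2\<close>.\<close>

datatype 'a mat2 = Mat2 'a 'a 'a 'a

fun mat2_mult :: "('a, 'b) ring_scheme \<Rightarrow> 'a mat2 \<Rightarrow> 'a mat2 \<Rightarrow> 'a mat2" where
  "mat2_mult A (Mat2 a b c d) (Mat2 a' b' c' d') =
     Mat2 (a \<otimes>\<^bsub>A\<^esub> a' \<oplus>\<^bsub>A\<^esub> b \<otimes>\<^bsub>A\<^esub> c') (a \<otimes>\<^bsub>A\<^esub> b' \<oplus>\<^bsub>A\<^esub> b \<otimes>\<^bsub>A\<^esub> d')
          (c \<otimes>\<^bsub>A\<^esub> a' \<oplus>\<^bsub>A\<^esub> d \<otimes>\<^bsub>A\<^esub> c') (c \<otimes>\<^bsub>A\<^esub> b' \<oplus>\<^bsub>A\<^esub> d \<otimes>\<^bsub>A\<^esub> d')"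

definition mat2_monoid :: "('a, 'b) ring_scheme \<Rightarrow> 'a mat2 monoid" where
  "mat2_monoid A =
     \<lparr>carrier = {M. set_mat2 M \<subseteq> carrier A},
      monoid.mult = mat2_mult A,
      one = Mat2 \<one>\<^bsub>A\<^esub> \<zero>\<^bsub>A\<^esub> \<zero>\<^bsub>A\<^esub> \<one>\<^bsub>A\<^esub>\<rparr>"

definition GL2 :: "('a, 'b) ring_scheme \<Rightarrow> 'a mat2 monoid" where
  "GL2 A = units_of (mat2_monoid A)"


section \<open>The group \<open>F\<close> and its images\<close>

definition M1 :: "laurent_xyt mat2" where
  "M1 = Mat2 1 (const_t (1 - y_var))
             0 (const_t x_var)"

definition M2T :: "laurent_xyt mat2" where
  "M2T = Mat2 (const_t y_var * t_var)     0
              (1 - const_t x_var * t_var) 1"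

definition F_group :: "laurent_xyt mat2 monoid" where
  "F_group = (GL2 Rt_ring)\<lparr>carrier := generate (GL2 Rt_ring) {M1, M2T}\<rparr>"

text \<open>
  A surjection from \<open>F_group\<close> determined by the ring map to \<open>S_ring q\<close>: its values are the
  matrices obtained by sending the entries to a commutative ring \<open>A\<close> along a homomorphism \<open>\<phi>\<close>
  under which the coefficients travel through \<open>S_ring q\<close>, i.e. the square formed by \<open>const_t\<close>,
  \<open>\<phi>\<close>, \<open>to_S q\<close> and \<open>\<psi>\<close> commutes. No condition is put on the image of \<open>t_var\<close>. Taking for \<open>A\<close>
  the Laurent polynomials in $t$ over \<open>S_ring q\<close>, for \<open>\<psi>\<close> the inclusion of the constants and
  for \<open>\<phi>\<close> the map fixing $t$ gives the group generated by the same two matrices over \<open>A\<close>.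
\<close>

definition sends_R_to_S ::
  "nat \<Rightarrow> ('a, 'b) ring_scheme \<Rightarrow> (laurent_xy set \<Rightarrow> 'a) \<Rightarrow> (laurent_xyt \<Rightarrow> 'a) \<Rightarrow> bool" where
  "sends_R_to_S q A \<psi> \<phi> \<longleftrightarrow>
     \<psi> \<in> ring_hom (S_ring q) A \<and> \<phi> \<in> ring_hom Rt_ring A \<and>
     (\<forall>r. \<phi> (const_t r) = \<psi> (to_S q r))"

definition gamma_image ::
  "('a, 'b) ring_scheme \<Rightarrow> (laurent_xyt mat2 \<Rightarrow> 'a mat2) \<Rightarrow> 'a mat2 monoid" where
  "gamma_image A \<gamma> = (GL2 A)\<lparr>carrier := \<gamma> ` carrier F_group\<rparr>"

end

(*
  Let N be the ideal generated by 1 - x and 1 - y. Modulo N the two generators are lower triangular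
  with columns summing to 1 and lower right entry 1, so F becomes commutative and its derived
  subgroup lies in the congruence subgroup of level N. Commutators of matrices that are trivial
  modulo N^k are trivial modulo N^(k+1), so the derived series descends through the levels N^k.

  The image of N under the map to A is nilpotent: in S both q(1 - x) and 1 - x^q vanish, and
  1 = (x + (1 - x))^q = x^q + (1 - x)^q modulo p, so (1 - x)^q is a multiple of p; its e-th power
  is a multiple of q and is therefore killed by 1 - x. The same holds for y.
*)

theory Submission
  imports Defs "HOL-Computational_Algebra.Primes"
begin

section \<open>Nilpotence of the augmentation ideal\<close>

lemma power_prime_add_mod:
  fixes u v :: "'a::comm_ring_1"
  assumes "Factorial_Ring.prime (p::nat)"
  shows "\<exists>r. (u + v) ^ p = u ^ p + v ^ p + of_nat p * r"
proof -
  have p: "p > 0" using assms prime_gt_0_nat by blast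
  have "\<exists>r. of_nat (p choose k) * u ^ k * v ^ (p - k) = of_nat p * r" if "k \<in> {1..<p}" for k
  proof -
    have "p dvd p choose k"
      by (rule dvd_choose_prime) (use that assms in auto)
    then obtain c where "p choose k = p * c" ..
    then have "of_nat (p choose k) * u ^ k * v ^ (p - k) = of_nat p * (of_nat c * u ^ k * v ^ (p - k))"
      by (simp add: mult.assoc)
    then show ?thesis ..
  qed
  then obtain r where r: "\<And>k. k \<in> {1..<p} \<Longrightarrow>
      of_nat (p choose k) * u ^ k * v ^ (p - k) = of_nat p * r k"
    by metis
  have "{..p} = insert 0 (insert p {1..<p})"
    using p by auto
  then have "(u + v) ^ p = u ^ p + v ^ p + (\<Sum>k\<in>{1..<p}. of_nat (p choose k) * u ^ k * v ^ (p - k))"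
    using p by (simp add: binomial_ring)
  also have "(\<Sum>k\<in>{1..<p}. of_nat (p choose k) * u ^ k * v ^ (p - k)) = of_nat p * (\<Sum>k\<in>{1..<p}. r k)"
    using r by (simp add: sum_distrib_left)
  finally show ?thesis by blast
qed

text \<open>Each further \<open>p\<close>-th power of the congruence keeps its error divisible by
  \<open>p\<close>: the old error \<open>p * r\<close> enters as \<open>(p * r) ^ p\<close>, again a
  multiple of \<open>p\<close> because \<open>p > 0\<close>.\<close>

lemma power_prime_power_add_mod:
  fixes u v :: "'a::comm_ring_1"
  assumes p: "Factorial_Ring.prime (p::nat)"
  shows "\<exists>r. (u + v) ^ (p ^ e) = u ^ (p ^ e) + v ^ (p ^ e) + of_nat p * r"
proof (induction e)
  case 0
  show ?case by (auto intro: exI[of _ 0])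
next
  case (Suc e)
  then obtain r where r: "(u + v) ^ (p ^ e) = (u ^ (p ^ e) + v ^ (p ^ e)) + of_nat p * r" by blast
  obtain r1 where r1: "((u ^ (p ^ e) + v ^ (p ^ e)) + of_nat p * r) ^ p
      = (u ^ (p ^ e) + v ^ (p ^ e)) ^ p + (of_nat p * r) ^ p + of_nat p * r1"
    using power_prime_add_mod[OF p] by blast
  obtain r2 where r2: "(u ^ (p ^ e) + v ^ (p ^ e)) ^ p
      = (u ^ (p ^ e)) ^ p + (v ^ (p ^ e)) ^ p + of_nat p * r2"
    using power_prime_add_mod[OF p] by blast
  have "(of_nat p * r) ^ p = of_nat p * (r * (of_nat p * r) ^ (p - 1))"
    using prime_gt_0_nat[OF p] by (cases p) (simp_all add: mult.assoc)
  then have "(u + v) ^ (p ^ Suc e) = u ^ (p ^ Suc e) + v ^ (p ^ Suc e)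
      + of_nat p * (r2 + r * (of_nat p * r) ^ (p - 1) + r1)"
    using r r1 r2 by (simp add: power_mult mult.commute[of p] distrib_left add.assoc)
  then show ?case by blast
qed

section \<open>Ideals in type-class rings and a nilpotence criterion\<close>

text \<open>Ideals as plain sets in a \<open>comm_ring_1\<close> type, so that memberships reduce to
  identities settled by ordinary ring simplification. Closure under negation comes from multiplying
  by -1.\<close>

locale class_ideal =
  fixes N :: "'a::comm_ring_1 set"
  assumes zero_mem [simp]: "0 \<in> N"
    and add_mem: "\<And>a b. \<lbrakk>a \<in> N; b \<in> N\<rbrakk> \<Longrightarrow> a + b \<in> N"
    and mult_mem: "\<And>a r. a \<in> N \<Longrightarrow> r * a \<in> N"
begin

lemma mult_mem_right: "a \<in> N \<Longrightarrow> a * r \<in> N"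
  using mult_mem[of a r] by (simp add: mult.commute)

lemma minus_mem: "a \<in> N \<Longrightarrow> - a \<in> N"
  using mult_mem[of a "-1"] by simp

lemma diff_mem: "\<lbrakk>a \<in> N; b \<in> N\<rbrakk> \<Longrightarrow> a - b \<in> N"
  using add_mem[of a "- b"] minus_mem by simp

lemma power_diff_mem: "a - b \<in> N \<Longrightarrow> a ^ n - b ^ n \<in> N"
  using mult_mem_right by (simp add: power_diff_sumr2)

text \<open>Meant for \<open>N = ISigma_ideal q\<close> and \<open>z\<close> a variable: hypothesis
  \<open>s\<close> comes from the geometric sum of the unit \<open>z\<close>, hypothesis
  \<open>q\<close> from that of the unit 1.\<close>

lemma one_minus_nilpotent:
  assumes p: "Factorial_Ring.prime (p::nat)"
    and s: "(\<Sum>k<p ^ e. z ^ k) * (1 - z) \<in> N"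
    and q: "of_nat (p ^ e) * (1 - z) \<in> N"
  shows "\<exists>m. (1 - z) ^ m \<in> N"
proof -
  define a where "a = 1 - z"
  obtain r where r: "(z + a) ^ (p ^ e) = z ^ (p ^ e) + a ^ (p ^ e) + of_nat p * r"
    using power_prime_power_add_mod[OF p] by blast
  have "1 - z ^ (p ^ e) \<in> N"
    using s by (simp add: one_diff_power_eq mult.commute)
  \<comment> \<open>The left side of \<open>r\<close> is 1, since \<open>z + a = 1\<close>.\<close>
  moreover have "1 - z ^ (p ^ e) = a ^ (p ^ e) - of_nat p * (- r)"
    using r by (simp add: a_def algebra_simps)
  \<comment> \<open>The \<open>e\<close>-th power turns the multiple of \<open>p\<close> into a
    multiple of \<open>p ^ e\<close>, which one more factor \<open>a\<close> sends into
    \<open>N\<close>.\<close>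
  ultimately have "(a ^ (p ^ e)) ^ e - (of_nat p * (- r)) ^ e \<in> N"
    by (intro power_diff_mem) simp
  then have "a * ((a ^ (p ^ e)) ^ e - (of_nat p * (- r)) ^ e) \<in> N"
    by (rule mult_mem)
  moreover have "(- r) ^ e * (of_nat (p ^ e) * a) \<in> N"
    using mult_mem q by (simp add: a_def)
  ultimately have "a * ((a ^ (p ^ e)) ^ e - (of_nat p * (- r)) ^ e) + (- r) ^ e * (of_nat (p ^ e) * a) \<in> N"
    by (rule add_mem)
  also have "a * ((a ^ (p ^ e)) ^ e - (of_nat p * (- r)) ^ e) + (- r) ^ e * (of_nat (p ^ e) * a)
      = a * (a ^ (p ^ e)) ^ e"
    by (simp only: power_mult_distrib of_nat_power right_diff_distrib mult_ac) simp
  also have "\<dots> = a ^ Suc (p ^ e * e)"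
    by (simp add: power_mult)
  finally show ?thesis
    unfolding a_def by blast
qed

end

section \<open>Powers of an ideal with two generators\<close>

text \<open>The \<open>n\<close>-th power of the ideal generated by \<open>a\<close> and
  \<open>b\<close>. Peeling off one generator at a time gives each element a two-term witness suited
  to induction.\<close>

primrec ideal_power2 :: "'a::comm_ring_1 \<Rightarrow> 'a \<Rightarrow> nat \<Rightarrow> 'a set" where
  "ideal_power2 a b 0 = UNIV"
| "ideal_power2 a b (Suc n) = {a * u + b * v | u v. u \<in> ideal_power2 a b n \<and> v \<in> ideal_power2 a b n}"

lemma class_ideal_ideal_power2: "class_ideal (ideal_power2 a b n)"
proof (induction n)
  case 0
  show ?case by unfold_locales auto
next
  case (Suc n)
  then interpret class_ideal "ideal_power2 a b n" .
  show ?case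
  proof
    show "0 \<in> ideal_power2 a b (Suc n)"
      by (auto intro!: exI[of _ 0])
  next
    fix c d assume "c \<in> ideal_power2 a b (Suc n)" "d \<in> ideal_power2 a b (Suc n)"
    then obtain u v u' v' where "c = a * u + b * v" "d = a * u' + b * v'"
      and mem: "u \<in> ideal_power2 a b n" "v \<in> ideal_power2 a b n"
        "u' \<in> ideal_power2 a b n" "v' \<in> ideal_power2 a b n"
      by auto
    then have "c + d = a * (u + u') + b * (v + v')" by (simp add: algebra_simps)
    with mem show "c + d \<in> ideal_power2 a b (Suc n)"
      using add_mem by auto
  next
    fix c r assume "c \<in> ideal_power2 a b (Suc n)"
    then obtain u v where "c = a * u + b * v"
      and mem: "u \<in> ideal_power2 a b n" "v \<in> ideal_power2 a b n"
      by auto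
    then have "r * c = a * (r * u) + b * (r * v)" by (simp add: algebra_simps)
    with mem show "r * c \<in> ideal_power2 a b (Suc n)"
      using mult_mem by auto
  qed
qed

text \<open>Source of the gain of one level for commutators in the congruence filtration.\<close>

lemma ideal_power2_mult:
  assumes "c \<in> ideal_power2 a b 1" "d \<in> ideal_power2 a b n"
  shows "c * d \<in> ideal_power2 a b (Suc n)"
proof -
  interpret class_ideal "ideal_power2 a b n" by (rule class_ideal_ideal_power2)
  obtain u v where "c = a * u + b * v" using assms(1) by auto
  then have "c * d = a * (u * d) + b * (v * d)" by (simp add: algebra_simps)
  then show ?thesis using mult_mem[OF assms(2)] by auto
qed

text \<open>Pigeonhole: a product of \<open>2 * m\<close> factors, each \<open>a\<close> or
  \<open>b\<close>, contains one of them at least \<open>m\<close> times.\<close>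

lemma (in class_ideal) ideal_power2_subset:
  assumes "a ^ m \<in> N" "b ^ m \<in> N"
  shows "ideal_power2 a b (2 * m) \<subseteq> N"
proof -
  have pow: "c ^ i \<in> N" if "c ^ m \<in> N" "m \<le> i" for c i
  proof -
    have "c ^ i = c ^ (i - m) * c ^ m" using that by (simp flip: power_add)
    then show ?thesis using that mult_mem by simp
  qed
  \<comment> \<open>Generators move one by one from \<open>c\<close> into the monomial, keeping
    \<open>i + j + k\<close> constant; at \<open>k = 0\<close> one of the exponents is at least
    \<open>m\<close>.\<close>
  have "a ^ i * b ^ j * c \<in> N" if "c \<in> ideal_power2 a b k" "2 * m \<le> i + j + k" for c i j k
    using that
  proof (induction k arbitrary: c i j)
    case 0
    then consider "m \<le> i" | "m \<le> j" by fastforce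
    then have "a ^ i * b ^ j \<in> N"
      using pow assms mult_mem mult_mem_right by cases blast+
    then show ?case by (rule mult_mem_right)
  next
    case (Suc k)
    then obtain u v where c: "c = a * u + b * v"
      and mem: "u \<in> ideal_power2 a b k" "v \<in> ideal_power2 a b k"
      by auto
    have "a ^ Suc i * b ^ j * u + a ^ i * b ^ Suc j * v \<in> N"
      using Suc.IH[OF mem(1), of "Suc i" j] Suc.IH[OF mem(2), of i "Suc j"] Suc.prems(2)
      by (intro add_mem) auto
    then show ?case by (simp add: c algebra_simps)
  qed
  from this[of _ "2 * m" 0 0] show ?thesis by auto
qed

section \<open>Matrix groups\<close>

lemma mat2_monoid_simps [simp]:
  "carrier (mat2_monoid A) = {M. set_mat2 M \<subseteq> carrier A}"
  "monoid.mult (mat2_monoid A) = mat2_mult A"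
  "one (mat2_monoid A) = Mat2 \<one>\<^bsub>A\<^esub> \<zero>\<^bsub>A\<^esub> \<zero>\<^bsub>A\<^esub> \<one>\<^bsub>A\<^esub>"
  by (simp_all add: mat2_monoid_def)

lemma GL2_simps [simp]:
  "carrier (GL2 A) = Units (mat2_monoid A)"
  "monoid.mult (GL2 A) = mat2_mult A"
  "one (GL2 A) = Mat2 \<one>\<^bsub>A\<^esub> \<zero>\<^bsub>A\<^esub> \<zero>\<^bsub>A\<^esub> \<one>\<^bsub>A\<^esub>"
  by (simp_all add: GL2_def units_of_def)

lemma (in cring) monoid_mat2: "monoid (mat2_monoid R)"
proof
  fix M N L
  assume "M \<in> carrier (mat2_monoid R)" "N \<in> carrier (mat2_monoid R)" "L \<in> carrier (mat2_monoid R)"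
  then show "M \<otimes>\<^bsub>mat2_monoid R\<^esub> N \<otimes>\<^bsub>mat2_monoid R\<^esub> L = M \<otimes>\<^bsub>mat2_monoid R\<^esub> (N \<otimes>\<^bsub>mat2_monoid R\<^esub> L)"
    by (cases M; cases N; cases L) (auto simp: l_distr r_distr m_assoc a_ac)
next
  fix M N
  assume "M \<in> carrier (mat2_monoid R)" "N \<in> carrier (mat2_monoid R)"
  then show "M \<otimes>\<^bsub>mat2_monoid R\<^esub> N \<in> carrier (mat2_monoid R)"
    by (cases M; cases N) auto
next
  fix M assume "M \<in> carrier (mat2_monoid R)"
  then show "\<one>\<^bsub>mat2_monoid R\<^esub> \<otimes>\<^bsub>mat2_monoid R\<^esub> M = M" "M \<otimes>\<^bsub>mat2_monoid R\<^esub> \<one>\<^bsub>mat2_monoid R\<^esub> = M"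
    by (cases M; auto)+
qed auto

lemma (in cring) group_GL2: "group (GL2 R)"
  unfolding GL2_def by (rule monoid.units_group[OF monoid_mat2])

lemma map_mat2_mult:
  assumes "\<phi> \<in> ring_hom A B" "set_mat2 M \<subseteq> carrier A" "set_mat2 N \<subseteq> carrier A" "ring A"
  shows "map_mat2 \<phi> (mat2_mult A M N) = mat2_mult B (map_mat2 \<phi> M) (map_mat2 \<phi> N)"
proof -
  interpret ring A by fact
  show ?thesis
    using assms(2,3)
    by (cases M; cases N) (simp add: ring_hom_add[OF assms(1)] ring_hom_mult[OF assms(1)])
qed

lemma map_mat2_one:
  assumes "\<phi> \<in> ring_hom A B" "ring A" "ring B"
  shows "map_mat2 \<phi> (one (mat2_monoid A)) = one (mat2_monoid B)"
  using ring_hom_one[OF assms(1)] ring_hom_zero[OF assms] by simp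

lemma map_mat2_group_hom:
  assumes hom: "\<phi> \<in> ring_hom A B" and A: "cring A" and B: "cring B"
  shows "group_hom (GL2 A) (GL2 B) (map_mat2 \<phi>)"
proof -
  interpret A: cring A by fact
  interpret B: cring B by fact
  have closed: "map_mat2 \<phi> M \<in> carrier (mat2_monoid B)" if "M \<in> carrier (mat2_monoid A)" for M
    using that ring_hom_closed[OF hom] by (auto simp: mat2.set_map)
  \<comment> \<open>The image of a two-sided inverse is a two-sided inverse of the image.\<close>
  have "map_mat2 \<phi> M \<in> Units (mat2_monoid B)" if M: "M \<in> Units (mat2_monoid A)" for M
  proof -
    obtain N where "M \<in> carrier (mat2_monoid A)" "N \<in> carrier (mat2_monoid A)"
      "mat2_mult A N M = one (mat2_monoid A)" "mat2_mult A M N = one (mat2_monoid A)"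
      using M by (auto simp: Units_def)
    then have "mat2_mult B (map_mat2 \<phi> N) (map_mat2 \<phi> M) = one (mat2_monoid B)"
      "mat2_mult B (map_mat2 \<phi> M) (map_mat2 \<phi> N) = one (mat2_monoid B)"
      "map_mat2 \<phi> M \<in> carrier (mat2_monoid B)" "map_mat2 \<phi> N \<in> carrier (mat2_monoid B)"
      using map_mat2_mult[OF hom _ _ A.ring_axioms] map_mat2_one[OF hom A.ring_axioms B.ring_axioms] closed
      by (metis mat2_monoid_simps(1) mem_Collect_eq)+
    then show ?thesis
      unfolding Units_def by auto
  qed
  then have "map_mat2 \<phi> \<in> hom (GL2 A) (GL2 B)"
    using map_mat2_mult[OF hom _ _ A.ring_axioms]
    by (auto simp: hom_def Units_def)
  then show ?thesis
    using A.group_GL2 B.group_GL2 by (simp add: group_hom_def group_hom_axioms_def)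
qed


section \<open>Congruence filtration of the general linear group\<close>

abbreviation GL2_class :: "'a::comm_ring_1 mat2 monoid" where
  "GL2_class \<equiv> GL2 ring_of_type_algebra"

lemma ring_of_type_algebra_simps [simp]:
  "carrier ring_of_type_algebra = UNIV"
  "monoid.mult ring_of_type_algebra = (*)"
  "one ring_of_type_algebra = 1"
  "ring.zero ring_of_type_algebra = 0"
  "add ring_of_type_algebra = (+)"
  by (simp_all add: ring_of_type_algebra_def)

interpretation GL2_class: group "GL2_class :: 'a::comm_ring_1 mat2 monoid"
  by (rule cring.group_GL2[OF cring_from_type_algebra])

fun mat2_cong :: "'a::comm_ring_1 set \<Rightarrow> 'a mat2 \<Rightarrow> 'a mat2 \<Rightarrow> bool" where
  "mat2_cong N (Mat2 a b c d) (Mat2 a' b' c' d') \<longleftrightarrow>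
     a - a' \<in> N \<and> b - b' \<in> N \<and> c - c' \<in> N \<and> d - d' \<in> N"

context class_ideal
begin

text \<open>The product is linear in its left factor. Subgroup closure and the commutator criterion
  both arise by multiplying a congruence on the right.\<close>

lemma mat2_cong_mult_right:
  assumes "mat2_cong N g h"
  shows "mat2_cong N (mat2_mult ring_of_type_algebra g k) (mat2_mult ring_of_type_algebra h k)"
proof -
  have "a * u + b * v - (a' * u + b' * v) \<in> N" if "a - a' \<in> N" "b - b' \<in> N" for a b a' b' u v
  proof -
    have "(a - a') * u + (b - b') * v \<in> N"
      using that mult_mem_right add_mem by blast
    then show ?thesis by (simp add: algebra_simps)
  qed
  then show ?thesis
    using assms by (cases g; cases h; cases k) simp
qed

lemma mat2_cong_refl: "mat2_cong N g g"
  by (cases g) simp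

lemma mat2_cong_sym: "mat2_cong N g h \<Longrightarrow> mat2_cong N h g"
  by (cases g; cases h) (use minus_mem in \<open>simp, metis minus_diff_eq\<close>)

lemma mat2_cong_trans:
  assumes "mat2_cong N g h" "mat2_cong N h k"
  shows "mat2_cong N g k"
proof -
  have "a - c \<in> N" if "a - b \<in> N" "b - c \<in> N" for a b c
    using add_mem[OF that] by simp
  then show ?thesis
    using assms by (cases g; cases h; cases k) (simp, blast)
qed

text \<open>The principal congruence subgroup of level \<open>N\<close>, that is, the kernel of
  reduction modulo \<open>N\<close>, described without forming the quotient ring.\<close>

definition congruence_subgroup :: "'a mat2 set" where
  "congruence_subgroup = {g \<in> carrier GL2_class. mat2_cong N g \<one>\<^bsub>GL2_class\<^esub>}"

lemma subgroup_congruence_subgroup: "subgroup congruence_subgroup GL2_class"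
proof (rule GL2_class.subgroupI)
  show "congruence_subgroup \<subseteq> carrier GL2_class"
    unfolding congruence_subgroup_def by blast
  show "congruence_subgroup \<noteq> {}"
    using GL2_class.one_closed mat2_cong_refl unfolding congruence_subgroup_def by blast
next
  fix g assume "g \<in> congruence_subgroup"
  then have g: "g \<in> carrier GL2_class" "mat2_cong N g \<one>\<^bsub>GL2_class\<^esub>"
    by (auto simp: congruence_subgroup_def)
  \<comment> \<open>After cancellation this compares the identity with the inverse of
    \<open>g\<close>.\<close>
  have "mat2_cong N (g \<otimes>\<^bsub>GL2_class\<^esub> inv\<^bsub>GL2_class\<^esub> g) (\<one>\<^bsub>GL2_class\<^esub> \<otimes>\<^bsub>GL2_class\<^esub> inv\<^bsub>GL2_class\<^esub> g)"
    unfolding GL2_simps(2) by (rule mat2_cong_mult_right[OF g(2)])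
  then show "inv\<^bsub>GL2_class\<^esub> g \<in> congruence_subgroup"
    using g(1) mat2_cong_sym unfolding congruence_subgroup_def
    by (simp del: GL2_simps)
next
  fix g h assume "g \<in> congruence_subgroup" "h \<in> congruence_subgroup"
  then have g: "g \<in> carrier GL2_class" "mat2_cong N g \<one>\<^bsub>GL2_class\<^esub>"
    and h: "h \<in> carrier GL2_class" "mat2_cong N h \<one>\<^bsub>GL2_class\<^esub>"
    by (auto simp: congruence_subgroup_def)
  have "mat2_cong N (g \<otimes>\<^bsub>GL2_class\<^esub> h) (\<one>\<^bsub>GL2_class\<^esub> \<otimes>\<^bsub>GL2_class\<^esub> h)"
    unfolding GL2_simps(2) by (rule mat2_cong_mult_right[OF g(2)])
  then show "g \<otimes>\<^bsub>GL2_class\<^esub> h \<in> congruence_subgroup"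
    using g(1) h mat2_cong_trans unfolding congruence_subgroup_def
    by (simp del: GL2_simps)
qed

text \<open>If \<open>gh\<close> and \<open>hg\<close> agree modulo \<open>N\<close>, multiplying by \<open>g\<^sup>-\<^sup>1h\<^sup>-\<^sup>1\<close> on the right shows that the
  commutator is trivial modulo \<open>N\<close>.\<close>

lemma derived_subset_congruence_subgroup:
  assumes H: "H \<subseteq> carrier GL2_class"
    and comm: "\<And>g h. \<lbrakk>g \<in> H; h \<in> H\<rbrakk> \<Longrightarrow> mat2_cong N (g \<otimes>\<^bsub>GL2_class\<^esub> h) (h \<otimes>\<^bsub>GL2_class\<^esub> g)"
  shows "derived GL2_class H \<subseteq> congruence_subgroup"
  unfolding derived_def
proof (rule GL2_class.generate_subgroup_incl[OF _ subgroup_congruence_subgroup], clarify)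
  fix g h assume gh: "g \<in> H" "h \<in> H"
  let ?k = "inv\<^bsub>GL2_class\<^esub> g \<otimes>\<^bsub>GL2_class\<^esub> inv\<^bsub>GL2_class\<^esub> h"
  have carr: "g \<in> carrier GL2_class" "h \<in> carrier GL2_class" using gh H by auto
  have "mat2_cong N (g \<otimes>\<^bsub>GL2_class\<^esub> h \<otimes>\<^bsub>GL2_class\<^esub> ?k) (h \<otimes>\<^bsub>GL2_class\<^esub> g \<otimes>\<^bsub>GL2_class\<^esub> ?k)"
    using mat2_cong_mult_right[OF comm[OF gh]] by (simp only: GL2_simps(2))
  moreover have "h \<otimes>\<^bsub>GL2_class\<^esub> g \<otimes>\<^bsub>GL2_class\<^esub> ?k = \<one>\<^bsub>GL2_class\<^esub>"
  proof -
    have "g \<otimes>\<^bsub>GL2_class\<^esub> ?k = inv\<^bsub>GL2_class\<^esub> h"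
      using carr by (simp add: GL2_class.m_assoc[symmetric] del: GL2_simps)
    then show ?thesis using carr by (simp add: GL2_class.m_assoc del: GL2_simps)
  qed
  moreover have "g \<otimes>\<^bsub>GL2_class\<^esub> h \<otimes>\<^bsub>GL2_class\<^esub> ?k
      = g \<otimes>\<^bsub>GL2_class\<^esub> h \<otimes>\<^bsub>GL2_class\<^esub> inv\<^bsub>GL2_class\<^esub> g \<otimes>\<^bsub>GL2_class\<^esub> inv\<^bsub>GL2_class\<^esub> h"
    using carr by (simp add: GL2_class.m_assoc del: GL2_simps)
  ultimately show "g \<otimes>\<^bsub>GL2_class\<^esub> h \<otimes>\<^bsub>GL2_class\<^esub> inv\<^bsub>GL2_class\<^esub> g \<otimes>\<^bsub>GL2_class\<^esub> inv\<^bsub>GL2_class\<^esub> h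
      \<in> congruence_subgroup"
    using carr unfolding congruence_subgroup_def
    by (simp del: GL2_simps)
qed

text \<open>Modulo \<open>N\<close> these are the matrices with rows \<open>(a, 0)\<close> and \<open>(1 - a, 1)\<close>, which multiply like
  their entries \<open>a\<close>.\<close>

definition column_sum_subgroup :: "'a mat2 set" where
  "column_sum_subgroup = {g \<in> carrier GL2_class.
     case g of Mat2 a b c d \<Rightarrow> b \<in> N \<and> 1 - d \<in> N \<and> 1 - (a + c) \<in> N}"

lemma subgroup_column_sum_subgroup: "subgroup column_sum_subgroup GL2_class"
proof (rule GL2_class.subgroupI)
  show "column_sum_subgroup \<subseteq> carrier GL2_class"
    unfolding column_sum_subgroup_def by blast
  show "column_sum_subgroup \<noteq> {}"
    using GL2_class.one_closed unfolding column_sum_subgroup_def by fastforce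
next
  fix g assume "g \<in> column_sum_subgroup"
  moreover obtain a b c d where g: "g = Mat2 a b c d" by (cases g)
  ultimately have carr: "g \<in> carrier GL2_class"
    and mem: "b \<in> N" "1 - d \<in> N" "1 - (a + c) \<in> N"
    by (auto simp: column_sum_subgroup_def)
  obtain a' b' c' d' where k: "inv\<^bsub>GL2_class\<^esub> g = Mat2 a' b' c' d'" by (cases "inv\<^bsub>GL2_class\<^esub> g")
  \<comment> \<open>Modulo \<open>N\<close>, \<open>b\<close> is 0 and \<open>d\<close> is 1, so
    these equations determine \<open>b'\<close> and \<open>d'\<close>. Adding the two equations
    \<open>gk\<close> below gives \<open>a' + c'\<close>, because \<open>a + c\<close> is 1 modulo
    \<open>N\<close>.\<close>
  have kg: "a' * b + b' * d = 0" "c' * b + d' * d = 1"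
    using GL2_class.l_inv[OF carr] unfolding k by (simp_all add: g)
  have gk: "a * a' + b * c' = 1" "c * a' + d * c' = 0"
    using GL2_class.r_inv[OF carr] unfolding k by (simp_all add: g)
  have "b' * (1 - d) - a' * b = b' - (a' * b + b' * d)"
    by (simp add: algebra_simps)
  then have "b' = b' * (1 - d) - a' * b"
    using kg(1) by simp
  moreover have "c' * b - d' * (1 - d) = (c' * b + d' * d) - d'"
    by (simp add: algebra_simps)
  then have "1 - d' = c' * b - d' * (1 - d)"
    using kg(2) by simp
  moreover have "b * c' - (1 - (a + c)) * a' - (1 - d) * c'
      = (a * a' + b * c') + (c * a' + d * c') - (a' + c')"
    by (simp add: algebra_simps)
  then have "1 - (a' + c') = b * c' - (1 - (a + c)) * a' - (1 - d) * c'"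
    using gk by simp
  ultimately have "b' \<in> N" "1 - d' \<in> N" "1 - (a' + c') \<in> N"
    using mem by (metis diff_mem mult_mem mult_mem_right)+
  then show "inv\<^bsub>GL2_class\<^esub> g \<in> column_sum_subgroup"
    using GL2_class.inv_closed[OF carr] k unfolding column_sum_subgroup_def by simp
next
  fix g h assume gh: "g \<in> column_sum_subgroup" "h \<in> column_sum_subgroup"
  obtain a b c d a' b' c' d' where g: "g = Mat2 a b c d" and h: "h = Mat2 a' b' c' d'"
    by (cases g; cases h)
  have mem: "b \<in> N" "1 - d \<in> N" "1 - (a + c) \<in> N" "b' \<in> N" "1 - d' \<in> N" "1 - (a' + c') \<in> N"
    using gh by (auto simp: column_sum_subgroup_def g h)
  note prods = mem[THEN mult_mem] mem[THEN mult_mem_right]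
  \<comment> \<open>This and the next two elements are, after expansion, the three defining
    conditions for the product.\<close>
  have "a * b' + b * d' \<in> N"
    by (rule mem prods | rule add_mem diff_mem)+
  moreover have "(1 - d) * d' + (1 - d') - c * b' \<in> N"
    by (rule mem prods | rule add_mem diff_mem)+
  moreover have "(1 - (a + c)) * a' + (1 - (a' + c')) + (1 - d) * c' - b * c' \<in> N"
    by (rule mem prods | rule add_mem diff_mem)+
  moreover have "g \<otimes>\<^bsub>GL2_class\<^esub> h \<in> carrier GL2_class"
    using gh GL2_class.m_closed unfolding column_sum_subgroup_def by blast
  ultimately show "g \<otimes>\<^bsub>GL2_class\<^esub> h \<in> column_sum_subgroup"
    unfolding column_sum_subgroup_def by (simp add: g h algebra_simps)
qed

lemma column_sum_subgroup_commute_mod: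
  assumes "g \<in> column_sum_subgroup" "h \<in> column_sum_subgroup"
  shows "mat2_cong N (g \<otimes>\<^bsub>GL2_class\<^esub> h) (h \<otimes>\<^bsub>GL2_class\<^esub> g)"
proof -
  obtain a b c d a' b' c' d' where g: "g = Mat2 a b c d" and h: "h = Mat2 a' b' c' d'"
    by (cases g; cases h)
  have mem: "b \<in> N" "1 - d \<in> N" "1 - (a + c) \<in> N" "b' \<in> N" "1 - d' \<in> N" "1 - (a' + c') \<in> N"
    using assms by (auto simp: column_sum_subgroup_def g h)
  note prods = mem[THEN mult_mem] mem[THEN mult_mem_right]
  have "b * c' - b' * c \<in> N"
    by (rule mem prods | rule add_mem diff_mem)+
  moreover have "a * b' + b * d' - a' * b - b' * d \<in> N"
    by (rule mem prods | rule add_mem diff_mem)+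
  \<comment> \<open>The lower left entry of \<open>gh - hg\<close>, rewritten through the column
    sums; the two copies of \<open>(1 - a) * (1 - a')\<close> cancel.\<close>
  moreover have "(1 - (a + c)) * (1 - a') - (1 - (a' + c')) * (1 - a) - (1 - d) * c' + (1 - d') * c \<in> N"
    by (rule mem prods | rule add_mem diff_mem)+
  moreover have "(1 - (a + c)) * (1 - a') - (1 - (a' + c')) * (1 - a) - (1 - d) * c' + (1 - d') * c
      = c * a' + d * c' - (c' * a + d' * c)"
    by (simp add: algebra_simps)
  moreover have "c * b' - c' * b \<in> N"
    by (rule mem prods | rule add_mem diff_mem)+
  ultimately show ?thesis
    by (simp add: g h algebra_simps)
qed

end

section \<open>Descent of commutators through powers of an ideal\<close>

text \<open>With \<open>g = 1 + X\<close> and \<open>h = 1 + Y\<close>,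
  \<open>gh - hg = XY - YX\<close> is quadratic in entries from \<open>N\<close>. The intended sets
  are the first power of an ideal for \<open>N1\<close>, a power for \<open>N\<close> and the next
  power for \<open>N'\<close>.\<close>

lemma congruence_subgroup_commute_mod:
  assumes sub: "N \<subseteq> N1" and prod: "\<And>c d. \<lbrakk>c \<in> N1; d \<in> N\<rbrakk> \<Longrightarrow> c * d \<in> N'"
    and N: "class_ideal N" and N': "class_ideal N'"
    and g: "g \<in> class_ideal.congruence_subgroup N" and h: "h \<in> class_ideal.congruence_subgroup N"
  shows "mat2_cong N' (g \<otimes>\<^bsub>GL2_class\<^esub> h) (h \<otimes>\<^bsub>GL2_class\<^esub> g)"
proof -
  interpret N: class_ideal N by fact
  interpret N': class_ideal N' by fact
  obtain a b c d a' b' c' d' where g': "g = Mat2 a b c d" and h': "h = Mat2 a' b' c' d'"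
    by (cases g; cases h)
  have mem: "a - 1 \<in> N" "b \<in> N" "c \<in> N" "d - 1 \<in> N" "a' - 1 \<in> N" "b' \<in> N" "c' \<in> N" "d' - 1 \<in> N"
    using g h by (auto simp: N.congruence_subgroup_def g' h')
  have prod': "u * v \<in> N'" if "u \<in> N" "v \<in> N" for u v
    using that prod sub by blast
  have "b * c' - b' * c \<in> N'"
    by (rule mem N'.diff_mem prod' N.diff_mem)+
  \<comment> \<open>The ones cancel in \<open>a - d\<close>, but display it as a difference of
    elements of \<open>N\<close>.\<close>
  moreover have "((a - 1) - (d - 1)) * b' - ((a' - 1) - (d' - 1)) * b \<in> N'"
    by (rule mem N'.diff_mem prod' N.diff_mem)+
  moreover have "((a' - 1) - (d' - 1)) * c - ((a - 1) - (d - 1)) * c' \<in> N'"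
    by (rule mem N'.diff_mem prod' N.diff_mem)+
  moreover have "c * b' - c' * b \<in> N'"
    by (rule mem N'.diff_mem prod' N.diff_mem)+
  ultimately show ?thesis
    by (simp add: g' h' algebra_simps)
qed

text \<open>The first derived subgroup reaches level 1 by commutativity modulo the ideal; every
  later one gains one power.\<close>

lemma exp_of_derived_column_sum_subset:
  fixes a b :: "'a::comm_ring_1"
  shows "(derived GL2_class ^^ Suc n) (class_ideal.column_sum_subgroup (ideal_power2 a b 1))
    \<subseteq> class_ideal.congruence_subgroup (ideal_power2 a b (Suc n))"
proof (induction n)
  case 0
  interpret class_ideal "ideal_power2 a b 1" by (rule class_ideal_ideal_power2)
  show ?case
    using derived_subset_congruence_subgroup[OF subgroup.subset[OF subgroup_column_sum_subgroup]
      column_sum_subgroup_commute_mod] by simp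
next
  case (Suc n)
  let ?N = "ideal_power2 a b (Suc n)" and ?N' = "ideal_power2 a b (Suc (Suc n))"
  interpret N: class_ideal ?N by (rule class_ideal_ideal_power2)
  interpret N': class_ideal ?N' by (rule class_ideal_ideal_power2)
  \<comment> \<open>The same two coefficients serve as witnesses, since the zeroth power is the
    whole ring.\<close>
  have "?N \<subseteq> ideal_power2 a b 1" by auto
  then have "derived GL2_class N.congruence_subgroup \<subseteq> N'.congruence_subgroup"
    by (intro N'.derived_subset_congruence_subgroup congruence_subgroup_commute_mod
        [OF _ ideal_power2_mult N.class_ideal_axioms N'.class_ideal_axioms]
        subgroup.subset[OF N.subgroup_congruence_subgroup])
  then show ?case
    using GL2_class.mono_derived[OF Suc.IH] by auto
qed

section \<open>The group \<open>F\<close>\<close>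

lemma mono_xy_mult: "mono_xy i j * mono_xy k l = mono_xy (i + k) (j + l)"
  by (simp add: mono_xy_def mult_single)

lemma mono_xy_zero: "mono_xy 0 0 = 1"
  by (simp add: mono_xy_def flip: zero_prod_def)

lemma const_t_one [simp]: "const_t 1 = 1"
  by (simp add: const_t_def)

lemma const_t_zero [simp]: "const_t 0 = 0"
  by (simp add: const_t_def)

lemma const_t_mult: "const_t (a * b) = const_t a * const_t b"
  by (simp add: const_t_def mult_single)

lemma const_t_diff: "const_t (a - b) = const_t a - const_t b"
  by (simp add: const_t_def single_diff)

lemma const_t_power: "const_t (a ^ n) = const_t a ^ n"
  by (induction n) (simp_all add: const_t_mult)

lemma ideal_power2_one_generators:
  fixes a b :: "'a::comm_ring_1"
  shows "a \<in> ideal_power2 a b 1 \<and> b \<in> ideal_power2 a b 1"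
proof -
  have "\<exists>u v. a = a * u + b * v" by (rule exI[of _ 1], rule exI[of _ 0]) simp
  moreover have "\<exists>u v. b = a * u + b * v" by (rule exI[of _ 0], rule exI[of _ 1]) simp
  ultimately show ?thesis by simp
qed

text \<open>Covers \<open>M1\<close> with \<open>u\<close> the constant \<open>x\<close>, and
  \<open>M2T\<close> with \<open>u = y * t\<close>.\<close>

lemma triangular_in_GL2:
  fixes u :: "'a::comm_ring_1"
  assumes u: "u * u' = 1"
  shows "Mat2 1 b 0 u \<in> carrier GL2_class" "Mat2 u 0 c 1 \<in> carrier GL2_class"
proof -
  have unit: "g \<in> carrier GL2_class"
    if "mat2_mult ring_of_type_algebra g h = Mat2 1 0 0 1"
      "mat2_mult ring_of_type_algebra h g = Mat2 1 0 0 1" for g h :: "'a mat2"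
    using that by (auto simp: Units_def)
  have inv: "mat2_mult ring_of_type_algebra (Mat2 1 b 0 u) (Mat2 1 (- (b * u')) 0 u') = Mat2 1 0 0 1"
    "mat2_mult ring_of_type_algebra (Mat2 1 (- (b * u')) 0 u') (Mat2 1 b 0 u) = Mat2 1 0 0 1"
    "mat2_mult ring_of_type_algebra (Mat2 u 0 c 1) (Mat2 u' 0 (- (c * u')) 1) = Mat2 1 0 0 1"
    "mat2_mult ring_of_type_algebra (Mat2 u' 0 (- (c * u')) 1) (Mat2 u 0 c 1) = Mat2 1 0 0 1"
    using u by (simp_all add: mult.assoc mult.commute[of u'])
  show "Mat2 1 b 0 u \<in> carrier GL2_class" "Mat2 u 0 c 1 \<in> carrier GL2_class"
    by (rule unit[OF inv(1,2)]) (rule unit[OF inv(3,4)])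
qed

lemma const_mono_unit: "const_t (mono_xy i j) * const_t (mono_xy (- i) (- j)) = 1"
  by (simp add: mono_xy_mult mono_xy_zero flip: const_t_mult)

lemma M1_M2T_in_GL2: "M1 \<in> carrier (GL2 Rt_ring)" "M2T \<in> carrier (GL2 Rt_ring)"
proof -
  show "M1 \<in> carrier (GL2 Rt_ring)"
    unfolding M1_def by (rule triangular_in_GL2(1)[OF const_mono_unit])
  have "const_t y_var * t_var * (const_t (mono_xy 0 (-1)) * Poly_Mapping.single (-1) 1)
      = (const_t y_var * const_t (mono_xy 0 (-1))) * (t_var * Poly_Mapping.single (-1) 1)"
    by (simp only: mult_ac)
  also have "\<dots> = 1"
    using const_mono_unit[of 0 1] by (simp add: t_var_def mult_single)
  finally show "M2T \<in> carrier (GL2 Rt_ring)"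
    unfolding M2T_def by (rule triangular_in_GL2(2))
qed

lemma subgroup_F: "subgroup (carrier F_group) (GL2 Rt_ring)"
  using GL2_class.generate_is_subgroup[of "{M1, M2T}"] M1_M2T_in_GL2 by (simp add: F_group_def)

lemma F_subset_column_sum_subgroup:
  "carrier F_group \<subseteq>
    class_ideal.column_sum_subgroup (ideal_power2 (const_t (1 - x_var)) (const_t (1 - y_var)) 1)"
proof -
  let ?a = "const_t (1 - x_var)" and ?b = "const_t (1 - y_var)"
  interpret class_ideal "ideal_power2 ?a ?b 1" by (rule class_ideal_ideal_power2)
  \<comment> \<open>The first column of \<open>M2T\<close> misses the sum 1 by
    \<open>(x - y) * t\<close>, which lies in the augmentation ideal.\<close>
  have "1 - (const_t y_var * t_var + (1 - const_t x_var * t_var)) = ?b * t_var - ?a * t_var"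
    by (simp add: const_t_diff algebra_simps)
  moreover have "?b * t_var - ?a * t_var \<in> ideal_power2 ?a ?b 1"
    using ideal_power2_one_generators[of ?a ?b] by (intro diff_mem mult_mem_right) blast+
  ultimately have "M2T \<in> column_sum_subgroup"
    using M1_M2T_in_GL2(2) unfolding column_sum_subgroup_def M2T_def
    by (simp del: ideal_power2.simps One_nat_def)
  moreover have "M1 \<in> column_sum_subgroup"
    using M1_M2T_in_GL2(1) ideal_power2_one_generators[of ?a ?b] zero_mem
    unfolding column_sum_subgroup_def M1_def
    by (simp add: const_t_diff del: ideal_power2.simps One_nat_def)
  ultimately have "generate (GL2 Rt_ring) {M1, M2T} \<subseteq> column_sum_subgroup"
    by (intro GL2_class.generate_subgroup_incl[OF _ subgroup_column_sum_subgroup]) blast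
  then show ?thesis by (simp add: F_group_def)
qed

section \<open>Nilpotence over S(q) and its transfer to \<open>A\<close>\<close>

lemma ideal_imp_class_ideal:
  assumes "ideal I ring_of_type_algebra"
  shows "class_ideal I"
proof -
  interpret ideal I ring_of_type_algebra by fact
  show ?thesis
    using additive_subgroup.zero_closed[OF is_additive_subgroup]
      additive_subgroup.a_closed[OF is_additive_subgroup] I_l_closed
    by unfold_locales simp_all
qed

lemma ideal_ISigma: "ideal (ISigma_ideal q) R_ring"
proof -
  interpret cring R_ring by (rule cring_from_type_algebra)
  show ?thesis
    unfolding ISigma_ideal_def I_ideal_def Sigma_ideal_def
    by (intro ideal_prod_is_ideal genideal_ideal) simp_all
qed

lemma geometric_sum_mult_in_ISigma:
  assumes "s \<in> {1 - x_var, 1 - y_var}"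
  shows "(\<Sum>k<q. mono_xy i j ^ k) * s \<in> ISigma_ideal q"
proof -
  interpret cring R_ring by (rule cring_from_type_algebra)
  have "(\<Sum>k<q. mono_xy i j ^ k) \<in> I_ideal q"
    unfolding I_ideal_def positive_units_def
    by (rule set_mp[OF genideal_self]) auto
  moreover have "s \<in> Sigma_ideal"
    unfolding Sigma_ideal_def by (rule set_mp[OF genideal_self]) (use assms in auto)
  ultimately show ?thesis
    unfolding ISigma_ideal_def using ideal_prod.prod[where R = R_ring] by fastforce
qed

text \<open>The membership hypothesis treats both variables at once.\<close>

lemma one_minus_var_nilpotent:
  assumes "Factorial_Ring.prime (p::nat)" "1 - mono_xy i j \<in> {1 - x_var, 1 - y_var}"
  shows "\<exists>m. (1 - mono_xy i j) ^ m \<in> ISigma_ideal (p ^ e)"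
proof -
  interpret class_ideal "ISigma_ideal (p ^ e)"
    by (rule ideal_imp_class_ideal[OF ideal_ISigma])
  show ?thesis
  proof (rule one_minus_nilpotent[OF assms(1)])
    show "(\<Sum>k<p ^ e. mono_xy i j ^ k) * (1 - mono_xy i j) \<in> ISigma_ideal (p ^ e)"
      by (rule geometric_sum_mult_in_ISigma[OF assms(2)])
    show "of_nat (p ^ e) * (1 - mono_xy i j) \<in> ISigma_ideal (p ^ e)"
      \<comment> \<open>For the unit 1 the geometric sum is the integer
        \<open>p ^ e\<close>.\<close>
      using geometric_sum_mult_in_ISigma[OF assms(2), where q = "p ^ e" and i = 0 and j = 0] by (simp add: mono_xy_zero)
  qed
qed

text \<open>Nilpotence in \<open>A\<close> becomes membership in this kernel, so the matrix
  computations stay over \<open>laurent_xyt\<close>.\<close>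

lemma class_ideal_kernel:
  assumes "\<phi> \<in> ring_hom ring_of_type_algebra A" "ring A"
  shows "class_ideal {r. \<phi> r = \<zero>\<^bsub>A\<^esub>}"
proof -
  interpret ring A by fact
  show ?thesis
    using ring_hom_zero[OF assms(1) ring_from_type_algebra assms(2)] ring_hom_closed[OF assms(1)]
      ring_hom_add[OF assms(1)] ring_hom_mult[OF assms(1)]
    by unfold_locales simp_all
qed

text \<open>Such an \<open>r\<close> has the same coset as 0, and \<open>\<phi>\<close> on constants
  depends only on the coset.\<close>

lemma sends_R_to_S_ISigma:
  assumes "sends_R_to_S q A \<psi> \<phi>" "ring A" "r \<in> ISigma_ideal q"
  shows "\<phi> (const_t r) = \<zero>\<^bsub>A\<^esub>"
proof -
  interpret ideal "ISigma_ideal q" R_ring by (rule ideal_ISigma)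
  have "to_S q r = to_S q 0"
    unfolding to_S_def using assms(3) a_rcos_const zero_closed
    by (metis additive_subgroup.zero_closed is_additive_subgroup ring_of_type_algebra_simps(4))
  then have "\<phi> (const_t r) = \<phi> (const_t 0)"
    using assms(1) by (simp add: sends_R_to_S_def del: const_t_zero)
  also have "\<dots> = \<zero>\<^bsub>A\<^esub>"
    using ring_hom_zero[OF _ ring_from_type_algebra assms(2), of \<phi>] assms(1)
    by (simp add: sends_R_to_S_def)
  finally show ?thesis .
qed

section \<open>Solvability of the image\<close>

theorem mainTheorem3:
  fixes p e q :: nat
    and A :: "('a, 'b) ring_scheme"
    and \<psi> :: "laurent_xy set \<Rightarrow> 'a"
    and \<phi> :: "laurent_xyt \<Rightarrow> 'a"
    and \<gamma> :: "laurent_xyt mat2 \<Rightarrow> 'a mat2"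
    and G :: "'a mat2 monoid"
  assumes "Factorial_Ring.prime p" and "e > 0" and "q = p ^ e"
    and "cring A"
    and "sends_R_to_S q A \<psi> \<phi>"
    and "\<gamma> = map_mat2 \<phi>"
    and "G = gamma_image A \<gamma>"
  shows "solvable G"
proof -
  interpret A: cring A by fact
  have hom: "\<phi> \<in> ring_hom Rt_ring A"
    using assms(5) by (simp add: sends_R_to_S_def)
  interpret \<gamma>: group_hom "GL2 Rt_ring" "GL2 A" \<gamma>
    unfolding \<open>\<gamma> = _\<close>
    by (rule map_mat2_group_hom[OF hom cring_from_type_algebra \<open>cring A\<close>])
  let ?a = "const_t (1 - x_var)" and ?b = "const_t (1 - y_var)" and ?P = "{r. \<phi> r = \<zero>\<^bsub>A\<^esub>}"
  interpret P: class_ideal ?P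
    by (rule class_ideal_kernel[OF hom A.ring_axioms])
  obtain m1 m2 where "(1 - x_var) ^ m1 \<in> ISigma_ideal q" "(1 - y_var) ^ m2 \<in> ISigma_ideal q"
    using one_minus_var_nilpotent[OF assms(1)] \<open>q = _\<close> by (metis insertCI)
  then have "?a ^ m1 \<in> ?P" "?b ^ m2 \<in> ?P"
    using sends_R_to_S_ISigma[OF assms(5) A.ring_axioms] const_t_power by (metis mem_Collect_eq)+
  \<comment> \<open>The pigeonhole lemma takes a common exponent for both generators.\<close>
  then have "?a ^ (m1 + m2) \<in> ?P" "?b ^ (m1 + m2) \<in> ?P"
    unfolding power_add using P.mult_mem P.mult_mem_right by blast+
  then have nil: "ideal_power2 ?a ?b (2 * (m1 + m2)) \<subseteq> ?P"
    by (rule P.ideal_power2_subset)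
  define n where "n = 2 * (m1 + m2)"
  let ?D = "(derived (GL2 Rt_ring) ^^ Suc n) (carrier F_group)"
  interpret N: class_ideal "ideal_power2 ?a ?b (Suc n)"
    by (rule class_ideal_ideal_power2)
  \<comment> \<open>\<open>nil\<close> concerns the exponent \<open>n\<close>, whereas the derived
    series is controlled at \<open>Suc n\<close>; decreasing powers bridge the gap.\<close>
  have "c \<in> ideal_power2 ?a ?b k" if "c \<in> ideal_power2 ?a ?b (Suc k)" for c k
  proof -
    interpret class_ideal "ideal_power2 ?a ?b k" by (rule class_ideal_ideal_power2)
    show ?thesis using that add_mem mult_mem by auto
  qed
  then have P: "ideal_power2 ?a ?b (Suc n) \<subseteq> ?P"
    using nil unfolding n_def by blast
  have D: "?D \<subseteq> N.congruence_subgroup"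
    using GL2_class.mono_exp_of_derived[OF F_subset_column_sum_subgroup] exp_of_derived_column_sum_subset
    by blast
  have "\<gamma> g = \<one>\<^bsub>GL2 A\<^esub>" if "g \<in> ?D" for g
  proof -
    obtain a b c d where g: "g = Mat2 a b c d" by (cases g)
    have "g \<in> N.congruence_subgroup" using that D by blast
    then have mem: "\<phi> (a - 1) = \<zero>\<^bsub>A\<^esub>" "\<phi> b = \<zero>\<^bsub>A\<^esub>" "\<phi> c = \<zero>\<^bsub>A\<^esub>" "\<phi> (d - 1) = \<zero>\<^bsub>A\<^esub>"
      using P by (auto simp: N.congruence_subgroup_def g simp del: ideal_power2.simps)
    have "\<phi> ((u - 1) + 1) = \<one>\<^bsub>A\<^esub>" if "\<phi> (u - 1) = \<zero>\<^bsub>A\<^esub>" for u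
      using that ring_hom_add[OF hom, of "u - 1" 1] ring_hom_one[OF hom] by simp
    with mem show ?thesis
      by (simp add: g \<open>\<gamma> = _\<close>)
  qed
  \<comment> \<open>Makes the image exactly the singleton of the identity rather than possibly
    empty.\<close>
  moreover have "?D \<noteq> {}"
    using subgroup.one_closed[OF GL2_class.exp_of_derived_is_subgroup[OF subgroup_F]] by blast
  ultimately have "\<gamma> ` ?D = {\<one>\<^bsub>GL2 A\<^esub>}"
    by (metis (no_types, lifting) image_constant_conv image_cong)
  \<comment> \<open>Homomorphisms commute with iterated derived subgroups.\<close>
  then have triv: "(derived (GL2 A) ^^ Suc n) (\<gamma> ` carrier F_group) = {\<one>\<^bsub>GL2 A\<^esub>}"
    using \<gamma>.exp_of_derived_img[OF subgroup.subset[OF subgroup_F]] by metis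
  have K: "subgroup (\<gamma> ` carrier F_group) (GL2 A)"
    by (rule \<gamma>.subgroup_img_is_subgroup[OF subgroup_F])
  interpret K: group G
    using \<gamma>.H.subgroup_imp_group[OF K] assms(7) by (simp add: gamma_image_def)
  have carrG: "carrier G = \<gamma> ` carrier F_group" and oneG: "\<one>\<^bsub>G\<^esub> = \<one>\<^bsub>GL2 A\<^esub>"
    by (simp_all add: assms(7) gamma_image_def)
  \<comment> \<open>Inverses, and hence commutators, are the same in the subgroup \<open>G\<close>
    as in \<open>GL2 A\<close>.\<close>
  have "(derived G ^^ k) (carrier G) = (derived (GL2 A) ^^ k) (carrier G)" for k
  proof (induction k)
    case (Suc k)
    have "(derived G ^^ k) (carrier G) \<subseteq> carrier G"
      by (rule K.exp_of_derived_in_carrier) simp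
    then show ?case
      using Suc \<gamma>.H.derived_consistent[OF _ K] carrG
      by (simp add: assms(7) gamma_image_def)
  qed simp
  then have "(derived G ^^ Suc n) (carrier G) = {\<one>\<^bsub>G\<^esub>}"
    using triv carrG oneG by metis
  then show ?thesis
    unfolding K.solvable_iff_trivial_derived_seq by blast
qed

end
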